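(* Let $\mathcal{I}=\mathcal{I}\langle a_j,\varphi_j\rangle_{j<\omega}$ be a fragmented ideal that is not gradually fragmented, such that every $\varphi_j$ is a uniform submeasure. Then $\mathfrak{b}(\mathcal{I})=\aleph_1$.
   Context: A submeasure on a finite set $a$ is a map $\varphi:\mathcal{P}(a)\to[0,+\infty)$ with $\varphi(\varnothing)=0$, monotone under $\subseteq$, and finitely subadditive. It is uniform if $\varphi(x)$ depends only on $|x|$. Given a partition $\{a_i\}_{i<\omega}$ of $\omega$ into nonempty finite sets and submeasures $\varphi_i$ on $\mathcal{P}(a_i)$, $\mathcal{I}\langle a_i,\varphi_i\rangle_{i<\omega}=\{x\subseteq\omega: \{\varphi_i(x\cap a_i)\}_{i<\omega}\text{ is bounded}\}$; ideals of this form are called fragmented. A fragmented ideal $\mathcal{I}\langle a_i,\varphi_i\rangle_{i<\omega}$ is gradually fragmented if for every $k<\omega$ there is $m<\omega$ such that for every $l<\omega$, for all but finitely many $i$, for every $B\subseteq\mathcal{P}(a_i)$ with $|B|\leq l$ and $\varphi_i(b)\leq k$ for all $b\in B$, we have $\varphi_i(\bigcup B)\leq m$ (this property does not depend on the chosen representation). For an ideal $\mathcal{I}$ on $\omega$ and $A,B\subseteq\omega$ write $A\subseteq_{\mathcal{I}}B$ iff $A\smallsetminus B\in\mathcal{I}$. A pair $\langle\mathcal{A},\mathcal{B}\rangle$ of families of subsets of $\omega$ is $\mathcal{I}$-orthogonal if $A\cap B\in\mathcal{I}$ for all $A\in\mathcal{A},B\in\mathcal{B}$; $C\subseteq\omega$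 separates it if $A\cap C\in\mathcal{I}$ for all $A\in\mathcal{A}$ and $B\subseteq_{\mathcal{I}}C$ for all $B\in\mathcal{B}$; an $\mathcal{I}$-gap is an $\mathcal{I}$-orthogonal pair that no set separates. $\mathfrak{b}(\mathcal{I})$ is the least $\lambda$ such that there is an $\mathcal{I}$-gap $\langle\mathcal{A},\mathcal{B}\rangle$ with $|\mathcal{A}|=\aleph_0$, $|\mathcal{B}|=\lambda$. *)

theory Defs
  imports Complex_Main "HOL-Library.Disjoint_Sets"
begin

unbundle cardinal_syntax

text \<open>A submeasure on a finite set \<open>a\<close> is a function on all sets of which only the values on
  subsets of \<open>a\<close> matter; every condition below is relativised to subsets of \<open>a\<close>.\<close>

definition submeasure_on :: "'a set \<Rightarrow> ('a set \<Rightarrow> real) \<Rightarrow> bool" where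
  "submeasure_on a \<phi> \<longleftrightarrow>
     finite a \<and>
     (\<forall>x. x \<subseteq> a \<longrightarrow> 0 \<le> \<phi> x) \<and>
     \<phi> {} = 0 \<and>
     (\<forall>x y. x \<subseteq> y \<and> y \<subseteq> a \<longrightarrow> \<phi> x \<le> \<phi> y) \<and>
     (\<forall>x y. x \<subseteq> a \<and> y \<subseteq> a \<longrightarrow> \<phi> (x \<union> y) \<le> \<phi> x + \<phi> y)"

definition uniform_on :: "'a set \<Rightarrow> ('a set \<Rightarrow> real) \<Rightarrow> bool" where
  "uniform_on a \<phi> \<longleftrightarrow>
     (\<forall>x y. x \<subseteq> a \<and> y \<subseteq> a \<and> card x = card y \<longrightarrow> \<phi> x = \<phi> y)"

definition fragmentation :: "(nat \<Rightarrow> nat set) \<Rightarrow> (nat \<Rightarrow> nat set \<Rightarrow> real) \<Rightarrow> bool" where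
  "fragmentation a \<phi> \<longleftrightarrow>
     disjoint_family a \<and> (\<Union>i. a i) = UNIV \<and>
     (\<forall>i. finite (a i) \<and> a i \<noteq> {}) \<and>
     (\<forall>i. submeasure_on (a i) (\<phi> i))"

definition fragmented_ideal :: "(nat \<Rightarrow> nat set) \<Rightarrow> (nat \<Rightarrow> nat set \<Rightarrow> real) \<Rightarrow> nat set set" where
  "fragmented_ideal a \<phi> = {x. Bseq (\<lambda>i. \<phi> i (x \<inter> a i))}"

definition gradually_fragmented :: "(nat \<Rightarrow> nat set) \<Rightarrow> (nat \<Rightarrow> nat set \<Rightarrow> real) \<Rightarrow> bool" where
  "gradually_fragmented a \<phi> \<longleftrightarrow>
     (\<forall>k::nat. \<exists>m::nat. \<forall>l::nat. \<forall>\<^sub>\<infinity>i.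
        \<forall>B. B \<subseteq> Pow (a i) \<and> card B \<le> l \<and> (\<forall>b\<in>B. \<phi> i b \<le> real k) \<longrightarrow> \<phi> i (\<Union>B) \<le> real m)"

definition subset_mod :: "nat set set \<Rightarrow> nat set \<Rightarrow> nat set \<Rightarrow> bool" where
  "subset_mod I A B \<longleftrightarrow> A - B \<in> I"

definition orthogonal_mod :: "nat set set \<Rightarrow> nat set set \<Rightarrow> nat set set \<Rightarrow> bool" where
  "orthogonal_mod I \<A> \<B> \<longleftrightarrow> (\<forall>A\<in>\<A>. \<forall>B\<in>\<B>. A \<inter> B \<in> I)"

definition separates_mod :: "nat set set \<Rightarrow> nat set \<Rightarrow> nat set set \<Rightarrow> nat set set \<Rightarrow> bool" where
  "separates_mod I C \<A> \<B> \<longleftrightarrow> (\<forall>A\<in>\<A>. A \<inter> C \<in> I) \<and> (\<forall>B\<in>\<B>. subset_mod I B C)"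

definition ideal_gap :: "nat set set \<Rightarrow> nat set set \<Rightarrow> nat set set \<Rightarrow> bool" where
  "ideal_gap I \<A> \<B> \<longleftrightarrow> orthogonal_mod I \<A> \<B> \<and> (\<nexists>C. separates_mod I C \<A> \<B>)"

text \<open>The equation \<open>\<bb>(I) = \<kappa>\<close>. It is a predicate rather than a function so that the existence of a
  gap of the required kind is part of the assertion. The number is only determined up to
  \<open>=o\<close>, cardinals being well-orders here.\<close>

definition is_rothberger_number :: "nat set set \<Rightarrow> 'c rel \<Rightarrow> bool" where
  "is_rothberger_number I \<kappa> \<longleftrightarrow>
     Card_order \<kappa> \<and>
     (\<exists>\<A> \<B>. ideal_gap I \<A> \<B> \<and> |\<A>| =o natLeq \<and> |\<B>| =o \<kappa>) \<and>
     (\<forall>\<A> \<B>. ideal_gap I \<A> \<B> \<and> |\<A>| =o natLeq \<longrightarrow> \<kappa> \<le>o |\<B>| )"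

lemma is_rothberger_number_unique:
  assumes "is_rothberger_number I \<kappa>" and "is_rothberger_number I \<mu>"
  shows "\<kappa> =o \<mu>"
proof -
  have "\<kappa> \<le>o \<mu>" and "\<mu> \<le>o \<kappa>"
    using assms unfolding is_rothberger_number_def by (meson ordLeq_ordIso_trans)+
  then show ?thesis
    by (simp add: ordIso_iff_ordLeq)
qed

end

theory Submission
  imports Defs "HOL-Library.Countable_Set_Type" "HOL-Library.Nat_Bijection"
begin

text \<open>Only countably many sets on either side never form a gap: after closing both sequences under
  finite unions, \<open>\<Union>n. B n - A n\<close> separates them. For the gap of size \<open>\<aleph>\<^sub>1\<close>, failure of gradual
  fragmentation yields a \<open>k\<close> and, for each \<open>m\<close>, infinitely many \<open>i\<close> with a boundedly large disjoint
  family of blocks in \<open>a i\<close>, each of measure at most \<open>k\<close>, whose union has measure above \<open>m\<close>. If \<open>C\<close> has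
  small measure then, by uniformity, the blocks that are more than half inside \<open>C\<close> have small union,
  so some union \<open>E\<close> of the remaining blocks has measure between \<open>n - k\<close> and \<open>n\<close>, and \<open>E - C\<close> still
  has at least half of it. Let \<open>A n\<close> collect the fragments of colour \<open>n\<close>, and let \<open>B x\<close> (for \<open>x\<close> in a
  set of \<open>\<aleph>\<^sub>1\<close> reals) pick in every fragment a union of blocks of measure at most its colour, so that
  any finitely many reals realise all unions of blocks on some fragment. If \<open>C\<close> separated these
  families, infinitely many \<open>B x - C\<close> would have a common bound \<open>d\<close>, which a fragment of
  colour \<open>2 * d + k + 1\<close> refutes.\<close>

section \<open>Submeasures and uniform submeasures on one finite set\<close>

lemma submeasure_onD:
  assumes "submeasure_on a \<phi>"
  shows submeasure_on_finite: "finite a"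
    and submeasure_on_nonneg: "x \<subseteq> a \<Longrightarrow> 0 \<le> \<phi> x"
    and submeasure_on_empty: "\<phi> {} = 0"
    and submeasure_on_mono: "x \<subseteq> y \<Longrightarrow> y \<subseteq> a \<Longrightarrow> \<phi> x \<le> \<phi> y"
    and submeasure_on_Un: "x \<subseteq> a \<Longrightarrow> y \<subseteq> a \<Longrightarrow> \<phi> (x \<union> y) \<le> \<phi> x + \<phi> y"
  using assms unfolding submeasure_on_def by blast+

lemma uniform_submeasure_card_mono:
  assumes "submeasure_on a \<phi>" "uniform_on a \<phi>" "x \<subseteq> a" "y \<subseteq> a" "card x \<le> card y"
  shows "\<phi> x \<le> \<phi> y"
proof -
  obtain z where z: "z \<subseteq> y" "card z = card x"
    using assms(5) by (meson obtain_subset_with_card_n)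
  then have "\<phi> x = \<phi> z"
    using assms(2-4) unfolding uniform_on_def by (metis subset_trans)
  also have "\<dots> \<le> \<phi> y"
    using submeasure_on_mono[OF assms(1) z(1) assms(4)] .
  finally show ?thesis .
qed

text \<open>Split \<open>x\<close> into two parts of size at most \<open>card y\<close>. This turns
  counting estimates up to a factor 2 into estimates of measure.\<close>

lemma uniform_submeasure_card_double:
  assumes "submeasure_on a \<phi>" "uniform_on a \<phi>" "x \<subseteq> a" "y \<subseteq> a" "card x \<le> 2 * card y"
  shows "\<phi> x \<le> 2 * \<phi> y"
proof -
  obtain z where z: "z \<subseteq> x" "card z = min (card x) (card y)"
    by (meson obtain_subset_with_card_n min.cobounded1)
  have fin: "finite z"
    using z(1) assms(3) submeasure_on_finite[OF assms(1)] by (meson finite_subset)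
  have "card (x - z) \<le> card y"
    using card_Diff_subset[OF fin z(1)] z(2) assms(5) by simp
  then have "\<phi> (x - z) \<le> \<phi> y" "\<phi> z \<le> \<phi> y"
    using uniform_submeasure_card_mono[OF assms(1,2) _ assms(4)] z assms(3)
    by (metis Diff_subset subset_trans, metis min.cobounded2 subset_trans)
  moreover have "\<phi> x \<le> \<phi> z + \<phi> (x - z)"
    using submeasure_on_Un[OF assms(1), of z "x - z"] z(1) assms(3)
    by (metis Diff_partition Diff_subset subset_trans)
  ultimately show ?thesis by simp
qed

text \<open>Remove blocks one at a time: each removal lowers the value by at most \<open>k\<close>,
  so the first value not above \<open>n\<close> is still at least \<open>n - k\<close>.\<close>

lemma submeasure_on_subfamily_between:
  fixes n k :: real
  assumes sub: "submeasure_on a \<phi>" and fin: "finite S" and Da: "\<And>b. b \<in> S \<Longrightarrow> D b \<subseteq> a"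
    and small: "\<And>b. b \<in> S \<Longrightarrow> \<phi> (D b) \<le> k"
    and n: "0 \<le> n" and big: "n < \<phi> (\<Union>b\<in>S. D b)"
  obtains R where "R \<subseteq> S" "\<phi> (\<Union>b\<in>R. D b) \<le> n" "n - k \<le> \<phi> (\<Union>b\<in>R. D b)"
proof -
  have "\<exists>R\<subseteq>S. \<phi> (\<Union>b\<in>R. D b) \<le> n \<and> n - k \<le> \<phi> (\<Union>b\<in>R. D b)"
    using fin Da small big
  proof (induction S rule: finite_induct)
    case empty
    then show ?case using n submeasure_on_empty[OF sub] by simp
  next
    case (insert s S)
    show ?case
    proof (cases "n < \<phi> (\<Union>b\<in>S. D b)")
      case True
      then show ?thesis using insert.IH insert.prems by (meson insertCI subset_insertI2)
    next
      case False
      have "\<phi> (\<Union>b\<in>insert s S. D b) \<le> \<phi> (D s) + \<phi> (\<Union>b\<in>S. D b)"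
        using submeasure_on_Un[OF sub, of "D s" "\<Union>b\<in>S. D b"] insert.prems(1) by auto
      moreover have "\<phi> (D s) \<le> k" using insert.prems(2) by simp
      ultimately have "n - k \<le> \<phi> (\<Union>b\<in>S. D b)" using insert.prems(3) by linarith
      then show ?thesis using False by (intro exI[of _ S]) auto
    qed
  qed
  then show thesis using that by blast
qed

text \<open>Disjointness makes the sizes of blocks add up, so halves can be compared block by block
  and then summed; uniformity converts the resulting counts into measures.\<close>

lemma uniform_blocks_escape:
  fixes n k c m :: real
  assumes sub: "submeasure_on a \<phi>" and uni: "uniform_on a \<phi>"
    and fin: "finite S" and Da: "\<And>b. b \<in> S \<Longrightarrow> D b \<subseteq> a"
    and disj: "disjoint_family_on D S"
    and small: "\<And>b. b \<in> S \<Longrightarrow> \<phi> (D b) \<le> k"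
    and big: "m < \<phi> (\<Union>b\<in>S. D b)"
    and n: "0 \<le> n" and m: "2 * c + n \<le> m" and C: "\<phi> (C \<inter> a) \<le> c"
  obtains R where "R \<subseteq> S" "\<phi> (\<Union>b\<in>R. D b) \<le> n" "(n - k) / 2 \<le> \<phi> ((\<Union>b\<in>R. D b) - C)"
proof -
  have fina: "finite a" using submeasure_on_finite[OF sub] .
  have finD: "finite (D b)" if "b \<in> S" for b
    using Da[OF that] fina by (meson finite_subset)
  have UNa: "(\<Union>b\<in>R. D b) \<subseteq> a" if "R \<subseteq> S" for R using that Da by blast
  have card_UN: "card ((\<Union>b\<in>R. D b) \<inter> X) = (\<Sum>b\<in>R. card (D b \<inter> X))" if "R \<subseteq> S" for R X
  proof -
    have "card (\<Union>b\<in>R. D b \<inter> X) = (\<Sum>b\<in>R. card (D b \<inter> X))"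
    proof (rule card_UN_disjoint)
      show "finite R" using that fin by (meson finite_subset)
      show "\<forall>i\<in>R. finite (D i \<inter> X)" using finD that by auto
      show "\<forall>i\<in>R. \<forall>j\<in>R. i \<noteq> j \<longrightarrow> D i \<inter> X \<inter> (D j \<inter> X) = {}"
        using disj that unfolding disjoint_family_on_def by blast
    qed
    moreover have "(\<Union>b\<in>R. D b) \<inter> X = (\<Union>b\<in>R. D b \<inter> X)" by auto
    ultimately show ?thesis by (simp only:)
  qed
  \<comment> \<open>The blocks at least half covered by \<open>C\<close>: together they have at most
    \<open>2 * card (C \<inter> a)\<close> points, hence measure at most
    \<open>2 * c\<close>.\<close>
  define P where "P = {b \<in> S. card (D b) \<le> 2 * card (D b \<inter> C)}"
  have P: "P \<subseteq> S" "S - P \<subseteq> S" unfolding P_def by auto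
  have "card (\<Union>b\<in>P. D b) = (\<Sum>b\<in>P. card (D b))"
    using card_UN[OF P(1), of UNIV] by simp
  also have "\<dots> \<le> (\<Sum>b\<in>P. 2 * card (D b \<inter> C))"
    by (rule sum_mono) (simp add: P_def)
  also have "\<dots> = 2 * card ((\<Union>b\<in>P. D b) \<inter> C)"
    using card_UN[OF P(1), of C] by (simp add: sum_distrib_left)
  also have "\<dots> \<le> 2 * card (C \<inter> a)"
    using UNa[OF P(1)] fina by (intro mult_left_mono card_mono) auto
  finally have "\<phi> (\<Union>b\<in>P. D b) \<le> 2 * \<phi> (C \<inter> a)"
    using uniform_submeasure_card_double[OF sub uni UNa[OF P(1)]] by auto
  moreover have "\<phi> (\<Union>b\<in>S. D b) \<le> \<phi> (\<Union>b\<in>P. D b) + \<phi> (\<Union>b\<in>S - P. D b)"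
  proof -
    have "(\<Union>b\<in>S. D b) = (\<Union>b\<in>P. D b) \<union> (\<Union>b\<in>S - P. D b)" using P by blast
    then show ?thesis using submeasure_on_Un[OF sub UNa[OF P(1)] UNa[OF P(2)]] by simp
  qed
  \<comment> \<open>The blocks outside \<open>P\<close> keep more than
    \<open>m - 2 * c \<ge> n\<close> and can be trimmed to \<open>R\<close>.\<close>
  ultimately have "n < \<phi> (\<Union>b\<in>S - P. D b)" using big m C by linarith
  then obtain R where R: "R \<subseteq> S - P" "\<phi> (\<Union>b\<in>R. D b) \<le> n" "n - k \<le> \<phi> (\<Union>b\<in>R. D b)"
    using submeasure_on_subfamily_between[OF sub, of "S - P" D k n] fin Da small n by auto
  have RS: "R \<subseteq> S" using R(1) by blast
  have "card (D b) \<le> 2 * card (D b \<inter> - C)" if "b \<in> R" for b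
  proof -
    have b: "b \<in> S" "b \<notin> P" using that R(1) by auto
    have "card (D b) = card (D b \<inter> C) + card (D b \<inter> - C)"
      using card_Int_Diff[OF finD[OF b(1)], of C] by (simp add: Diff_eq)
    then show ?thesis using b unfolding P_def by simp
  qed
  then have "(\<Sum>b\<in>R. card (D b)) \<le> (\<Sum>b\<in>R. 2 * card (D b \<inter> - C))"
    by (rule sum_mono)
  then have "card (\<Union>b\<in>R. D b) \<le> 2 * card ((\<Union>b\<in>R. D b) - C)"
    using card_UN[OF RS, of UNIV] card_UN[OF RS, of "- C"]
    by (simp add: sum_distrib_left Diff_eq)
  then have "\<phi> (\<Union>b\<in>R. D b) \<le> 2 * \<phi> ((\<Union>b\<in>R. D b) - C)"
    using UNa[OF RS] by (intro uniform_submeasure_card_double[OF sub uni]) auto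
  then show thesis using that[OF RS R(2)] R(3) by simp
qed

section \<open>Escaping families from the failure of gradual fragmentation\<close>

text \<open>Retains only what the gap construction uses of the blocks. The budget
  \<open>2 * c + n \<le> m\<close> comes from \<open>uniform_blocks_escape\<close>; indices from
  \<open>N\<close> on are padding.\<close>

definition escaping_family ::
    "nat set \<Rightarrow> (nat set \<Rightarrow> real) \<Rightarrow> nat \<Rightarrow> nat \<Rightarrow> nat \<Rightarrow> (nat \<Rightarrow> nat set) \<Rightarrow> bool" where
  "escaping_family a \<phi> k m N E \<longleftrightarrow>
     (\<forall>v. E v \<subseteq> a) \<and>
     (\<forall>n c C. 2 * c + n \<le> m \<and> \<phi> (C \<inter> a) \<le> real c \<longrightarrow>
        (\<exists>v<N. \<phi> (E v) \<le> real n \<and> (real n - real k) / 2 \<le> \<phi> (E v - C)))"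

text \<open>The candidates are the unions of subfamilies of the disjointified \<open>B\<close>;
  their number is bounded in terms of \<open>l\<close> alone, whatever the size of
  \<open>a\<close>.\<close>

lemma escaping_family_exists:
  assumes sub: "submeasure_on a \<phi>" and uni: "uniform_on a \<phi>"
    and B: "B \<subseteq> Pow a" "card B \<le> l" "\<forall>b\<in>B. \<phi> b \<le> real k" "real m < \<phi> (\<Union>B)"
  shows "\<exists>E. escaping_family a \<phi> k m (2 ^ l) E"
proof -
  have finB: "finite B"
    using B(1) submeasure_on_finite[OF sub] by (meson finite_Pow_iff finite_subset)
  have "\<forall>x\<in>\<Union>B. \<exists>b\<in>B. x \<in> b" by blast
  then obtain f where f: "\<And>x. x \<in> \<Union>B \<Longrightarrow> f x \<in> B \<and> x \<in> f x" by metis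
  \<comment> \<open>Each point stays only in the member \<open>f x\<close>: the blocks become
    disjoint with the same union, and monotonicity preserves the bound \<open>k\<close>.\<close>
  define D where "D b = {x \<in> \<Union>B. f x = b}" for b
  have Db: "D b \<subseteq> b" for b using f unfolding D_def by auto
  have Da: "D b \<subseteq> a" if "b \<in> B" for b using Db[of b] that B(1) by blast
  have small: "\<phi> (D b) \<le> real k" if "b \<in> B" for b
    using submeasure_on_mono[OF sub Db[of b]] that B(1,3) by (meson PowD order_trans subsetD)
  have disj: "disjoint_family_on D B"
    unfolding disjoint_family_on_def D_def by auto
  have "(\<Union>b\<in>B. D b) = \<Union>B" using f unfolding D_def by auto
  then have big: "real m < \<phi> (\<Union>b\<in>B. D b)" using B(4) by simp
  have "card (Pow B) \<le> card {..<(2::nat) ^ l}"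
    using B(2) finB by (simp add: card_Pow power_increasing)
  then obtain g where g: "inj_on (g :: _ \<Rightarrow> nat) (Pow B)" "g ` Pow B \<subseteq> {..<2 ^ l}"
    using finB by (metis card_le_inj finite_Pow_iff finite_lessThan)
  \<comment> \<open>The default \<open>{}\<close> keeps \<open>E v\<close> inside \<open>a\<close>
    for every index.\<close>
  define E where "E v = (if v \<in> g ` Pow B then (\<Union>b\<in>inv_into (Pow B) g v. D b) else {})" for v
  have E: "E (g R) = (\<Union>b\<in>R. D b)" if "R \<subseteq> B" for R
    using that g(1) unfolding E_def by simp
  have Esub: "E v \<subseteq> a" for v
    unfolding E_def using Da inv_into_into[of v g "Pow B"] by auto
  have "\<exists>v<2 ^ l. \<phi> (E v) \<le> real n \<and> (real n - real k) / 2 \<le> \<phi> (E v - C)"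
    if "2 * c + n \<le> m" "\<phi> (C \<inter> a) \<le> real c" for n c C
  proof -
    have "2 * real c + real n \<le> real m" using that(1) by linarith
    from uniform_blocks_escape[OF sub uni finB Da disj small big _ this that(2)]
    obtain R where "R \<subseteq> B" "\<phi> (\<Union>b\<in>R. D b) \<le> real n"
        "(real n - real k) / 2 \<le> \<phi> ((\<Union>b\<in>R. D b) - C)"
      by auto
    moreover have "g R < 2 ^ l" using \<open>R \<subseteq> B\<close> g(2) by blast
    ultimately show ?thesis using E by (intro exI[of _ "g R"]) simp
  qed
  with Esub show ?thesis unfolding escaping_family_def by blast
qed

text \<open>In the negated definition \<open>k\<close> is chosen before \<open>m\<close>, and
  \<open>l\<close> depends on \<open>m\<close> alone, so one bound \<open>2 ^ l m\<close> serves
  infinitely many fragments.\<close>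

lemma not_gradually_fragmented_escaping:
  assumes "fragmentation a \<phi>" "\<not> gradually_fragmented a \<phi>" "\<And>j. uniform_on (a j) (\<phi> j)"
  obtains k N where "\<And>m. infinite {i. \<exists>E. escaping_family (a i) (\<phi> i) k m (N m) E}"
proof -
  obtain k :: nat where "\<forall>m::nat. \<exists>l::nat. \<exists>\<^sub>\<infinity>i. \<exists>B. B \<subseteq> Pow (a i) \<and> card B \<le> l \<and>
      (\<forall>b\<in>B. \<phi> i b \<le> real k) \<and> real m < \<phi> i (\<Union>B)"
    using assms(2) unfolding gradually_fragmented_def by (auto simp: not_le)
  from choice[OF this] obtain l where l: "\<And>m::nat. \<exists>\<^sub>\<infinity>i. \<exists>B. B \<subseteq> Pow (a i) \<and> card B \<le> l m \<and>
      (\<forall>b\<in>B. \<phi> i b \<le> real k) \<and> real m < \<phi> i (\<Union>B)"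
    by blast
  have "\<exists>\<^sub>\<infinity>i. \<exists>E. escaping_family (a i) (\<phi> i) k m (2 ^ l m) E" for m
    using l[of m]
  proof (rule INFM_mono)
    fix i
    assume "\<exists>B\<subseteq>Pow (a i). card B \<le> l m \<and> (\<forall>b\<in>B. \<phi> i b \<le> real k) \<and> real m < \<phi> i (\<Union>B)"
    then show "\<exists>E. escaping_family (a i) (\<phi> i) k m (2 ^ l m) E"
      using escaping_family_exists[of "a i" "\<phi> i"] assms(1,3)
      unfolding fragmentation_def by blast
  qed
  then show thesis
    using that[of k "\<lambda>m. 2 ^ l m"] by (simp add: frequently_cofinite)
qed

section \<open>Closure properties of fragmented ideals\<close>

text \<open>Nonnegativity removes the norm in \<open>Bseq\<close>; natural bounds suit the later
  pigeonhole and the budget \<open>2 * c + n\<close>.\<close>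

lemma fragmented_ideal_iff:
  assumes "fragmentation a \<phi>"
  shows "x \<in> fragmented_ideal a \<phi> \<longleftrightarrow> (\<exists>K::nat. \<forall>i. \<phi> i (x \<inter> a i) \<le> real K)"
proof -
  have nn: "0 \<le> \<phi> i (x \<inter> a i)" for i
    using assms submeasure_on_nonneg unfolding fragmentation_def by (metis Int_lower2)
  show ?thesis
  proof
    assume "x \<in> fragmented_ideal a \<phi>"
    then obtain K where K: "\<And>i. norm (\<phi> i (x \<inter> a i)) \<le> K"
      unfolding fragmented_ideal_def Bseq_def by blast
    obtain M :: nat where "K \<le> real M" using real_arch_simple by blast
    then show "\<exists>K::nat. \<forall>i. \<phi> i (x \<inter> a i) \<le> real K"
      using K nn by (intro exI[of _ M]) (metis abs_of_nonneg order_trans real_norm_def)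
  next
    assume "\<exists>K::nat. \<forall>i. \<phi> i (x \<inter> a i) \<le> real K"
    then obtain K :: nat where "\<And>i. norm (\<phi> i (x \<inter> a i)) \<le> real K" using nn by auto
    then have "Bseq (\<lambda>i. \<phi> i (x \<inter> a i))" by (rule BseqI')
    then show "x \<in> fragmented_ideal a \<phi>" unfolding fragmented_ideal_def by simp
  qed
qed

lemma fragmented_ideal_mono:
  assumes "fragmentation a \<phi>" "y \<in> fragmented_ideal a \<phi>" "x \<subseteq> y"
  shows "x \<in> fragmented_ideal a \<phi>"
proof -
  have "\<phi> i (x \<inter> a i) \<le> \<phi> i (y \<inter> a i)" for i
    using assms(1,3) unfolding fragmentation_def
    by (intro submeasure_on_mono[of "a i"]) auto
  then show ?thesis
    using assms(2) unfolding fragmented_ideal_iff[OF assms(1)] by (meson order_trans)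
qed

lemma fragmented_ideal_Un:
  assumes "fragmentation a \<phi>" "x \<in> fragmented_ideal a \<phi>" "y \<in> fragmented_ideal a \<phi>"
  shows "x \<union> y \<in> fragmented_ideal a \<phi>"
proof -
  obtain K L :: nat where KL: "\<And>i. \<phi> i (x \<inter> a i) \<le> K" "\<And>i. \<phi> i (y \<inter> a i) \<le> L"
    using assms(2,3) unfolding fragmented_ideal_iff[OF assms(1)] by blast
  have "\<phi> i ((x \<union> y) \<inter> a i) \<le> real (K + L)" for i
  proof -
    have "\<phi> i ((x \<inter> a i) \<union> (y \<inter> a i)) \<le> \<phi> i (x \<inter> a i) + \<phi> i (y \<inter> a i)"
      using assms(1) unfolding fragmentation_def by (intro submeasure_on_Un[of "a i"]) auto
    then show ?thesis using KL[of i] by (simp add: Int_Un_distrib2)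
  qed
  then show ?thesis unfolding fragmented_ideal_iff[OF assms(1)] by blast
qed

lemma fragmented_ideal_empty:
  assumes "fragmentation a \<phi>"
  shows "{} \<in> fragmented_ideal a \<phi>"
proof -
  have "\<phi> i {} = 0" for i
    using assms submeasure_on_empty unfolding fragmentation_def by metis
  then show ?thesis unfolding fragmented_ideal_iff[OF assms] by (intro exI[of _ 0]) simp
qed

lemma fragmented_ideal_UN:
  assumes "fragmentation a \<phi>" "finite S" "\<And>s. s \<in> S \<Longrightarrow> X s \<in> fragmented_ideal a \<phi>"
  shows "(\<Union>s\<in>S. X s) \<in> fragmented_ideal a \<phi>"
  using assms(2,3)
  by (induction S rule: finite_induct)
    (auto intro: fragmented_ideal_empty fragmented_ideal_Un assms(1))

section \<open>Lower bound: countable families are separated\<close>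

lemma countable_families_not_gap:
  assumes frag: "fragmentation a \<phi>" and "countable \<A>" "countable \<B>"
  shows "\<not> ideal_gap (fragmented_ideal a \<phi>) \<A> \<B>"
proof
  let ?I = "fragmented_ideal a \<phi>"
  assume gap: "ideal_gap ?I \<A> \<B>"
  \<comment> \<open>Adding \<open>{}\<close> makes a family nonempty, so that \<open>nat\<close>
    enumerates it, and preserves orthogonality.\<close>
  obtain f where f: "\<A> \<subseteq> range (f :: nat \<Rightarrow> nat set)" "range f \<subseteq> insert {} \<A>"
    using range_from_nat_into[of "insert {} \<A>"] assms(2)
    by (metis countable_insert insert_not_empty subset_insertI subset_refl)
  obtain g where g: "\<B> \<subseteq> range (g :: nat \<Rightarrow> nat set)" "range g \<subseteq> insert {} \<B>"
    using range_from_nat_into[of "insert {} \<B>"] assms(3)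
    by (metis countable_insert insert_not_empty subset_insertI subset_refl)
  have orth: "f i \<inter> g j \<in> ?I" for i j
  proof -
    have "f i \<in> insert {} \<A>" "g j \<in> insert {} \<B>" using f(2) g(2) by blast+
    then show ?thesis
      using gap fragmented_ideal_empty[OF frag]
      unfolding ideal_gap_def orthogonal_mod_def by auto
  qed
  define F where "F n = (\<Union>i\<le>n. f i)" for n :: nat
  define G where "G n = (\<Union>i\<le>n. g i)" for n :: nat
  have FG: "F i \<inter> G j \<in> ?I" for i j
  proof -
    have "F i \<inter> G j = (\<Union>p\<in>{..i}\<times>{..j}. f (fst p) \<inter> g (snd p))"
      unfolding F_def G_def by force
    then show ?thesis
      using fragmented_ideal_UN[OF frag, of "{..i}\<times>{..j}" "\<lambda>p. f (fst p) \<inter> g (snd p)"] orth by simp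
  qed
  have "separates_mod ?I (\<Union>n. G n - F n) \<A> \<B>"
    unfolding separates_mod_def subset_mod_def
  proof (intro conjI ballI)
    fix A assume "A \<in> \<A>"
    then obtain i where i: "A = f i" using f(1) by auto
    \<comment> \<open>Since \<open>f i \<subseteq> F n\<close> for \<open>n \<ge> i\<close>, only
      stages \<open>n < i\<close> meet \<open>f i\<close>, and these lie in
      \<open>G i\<close>.\<close>
    have "A \<inter> (\<Union>n. G n - F n) \<subseteq> F i \<inter> G i"
    proof
      fix x assume "x \<in> A \<inter> (\<Union>n. G n - F n)"
      then obtain n where n: "x \<in> f i" "x \<in> G n" "x \<notin> F n" using i by auto
      then have "n < i" unfolding F_def by (metis UN_I atMost_iff not_le)
      then have "G n \<subseteq> G i" unfolding G_def by (auto intro: less_imp_le order_trans)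
      then show "x \<in> F i \<inter> G i" using n unfolding F_def by auto
    qed
    then show "A \<inter> (\<Union>n. G n - F n) \<in> ?I" using fragmented_ideal_mono[OF frag FG] by blast
  next
    fix B assume "B \<in> \<B>"
    then obtain j where "B = g j" using g(1) by auto
    then have "B \<subseteq> G j" unfolding G_def by auto
    \<comment> \<open>Points of \<open>G j\<close> missing from stage \<open>j\<close> lie in
      \<open>F j\<close>.\<close>
    then have "B - (\<Union>n. G n - F n) \<subseteq> F j \<inter> G j" by blast
    then show "B - (\<Union>n. G n - F n) \<in> ?I" using fragmented_ideal_mono[OF frag FG] by blast
  qed
  then show False using gap unfolding ideal_gap_def by blast
qed

text \<open>Serves twice: for the lower bound in the theorem, and to show that the constructed
  right-hand family is large enough.\<close>

lemma gap_uncountable: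
  assumes "fragmentation a \<phi>" "ideal_gap (fragmented_ideal a \<phi>) \<A> \<B>" "|\<A>| =o natLeq"
  shows "cardSuc natLeq \<le>o |\<B>|"
proof -
  have "countable \<A>"
    using assms(3) by (metis countable_card_le_natLeq ordIso_imp_ordLeq)
  then have "\<not> |\<B>| \<le>o natLeq"
    using countable_families_not_gap assms(1,2) countable_card_le_natLeq by blast
  then have "natLeq <o |\<B>|"
    using not_ordLeq_iff_ordLess[OF natLeq_Well_order card_of_Well_order] by blast
  then show ?thesis
    using cardSuc_ordLess_ordLeq[OF natLeq_Card_order card_of_Card_order] by blast
qed

section \<open>Sets of naturals: interpolation, choice and cardinality\<close>

lemma finite_reals_separated_by_prefix:
  fixes F :: "nat set set"
  assumes "finite F"
  obtains s where "inj_on (\<lambda>x. x \<inter> {..<s}) F"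
proof -
  have "\<forall>x y. \<exists>z. x \<noteq> y \<longrightarrow> (z \<in> x) \<noteq> (z \<in> (y :: nat set))" by blast
  then obtain z where z: "\<And>x y. x \<noteq> y \<Longrightarrow> (z x y \<in> x) \<noteq> (z x y \<in> (y :: nat set))" by metis
  obtain s where s: "\<forall>p\<in>(\<lambda>(x, y). z x y) ` (F \<times> F). p < s"
    using assms finite_nat_set_iff_bounded by (metis finite_SigmaI finite_imageI)
  have "inj_on (\<lambda>x. x \<inter> {..<s}) F"
  proof (rule inj_onI, rule ccontr)
    fix x y assume xy: "x \<in> F" "y \<in> F" "x \<inter> {..<s} = y \<inter> {..<s}" "x \<noteq> y"
    then have "z x y < s" using s by auto
    then show False using z[OF xy(4)] xy(3) by (metis IntD1 IntI lessThan_iff)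
  qed
  then show thesis using that by blast
qed

text \<open>A countable dense set in the product of continuum many copies of discrete \<omega>
  (Hewitt-Marczewski-Pondiczery). An index codes a length \<open>s\<close> and a finite table keyed
  by prefixes of length \<open>s\<close>; long enough prefixes tell the members of \<open>F\<close>
  apart.\<close>

lemma countable_interpolating_family:
  obtains T :: "nat \<Rightarrow> nat set \<Rightarrow> nat"
  where "\<And>F f. finite F \<Longrightarrow> \<exists>t. \<forall>x\<in>F. T t x = f x"
proof -
  define T :: "nat \<Rightarrow> nat set \<Rightarrow> nat" where
    "T t x = (case from_nat t :: nat \<times> (nat \<times> nat) list of
        (s, ps) \<Rightarrow> the (map_of ps (set_encode (x \<inter> {..<s}))))" for t x
  have "\<exists>t. \<forall>x\<in>F. T t x = f x" if F: "finite F" for F :: "nat set set" and f :: "nat set \<Rightarrow> nat"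
  proof -
    obtain s where s: "inj_on (\<lambda>x. x \<inter> {..<s}) F"
      using finite_reals_separated_by_prefix[OF F] .
    let ?e = "\<lambda>x. set_encode (x \<inter> {..<s})"
    have e: "inj_on ?e F"
      using s unfolding inj_on_def by (simp add: set_encode_eq)
    obtain xs where xs: "set xs = F" "distinct xs"
      using finite_distinct_list[OF F] by blast
    define ps where "ps = map (\<lambda>x. (?e x, f x)) xs"
    have "map_of ps (?e x) = Some (f x)" if "x \<in> F" for x
    proof (rule map_of_is_SomeI)
      show "distinct (map fst ps)"
        using xs e unfolding ps_def by (simp add: distinct_map comp_def)
      show "(?e x, f x) \<in> set ps" using that xs unfolding ps_def by auto
    qed
    then show ?thesis
      by (intro exI[of _ "to_nat (s, ps)"]) (simp add: T_def)
  qed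
  then show thesis using that by blast
qed

text \<open>Strictness will put different positions on different fragments.\<close>

lemma strict_mono_choice:
  fixes Y :: "nat \<Rightarrow> nat set"
  assumes "\<And>j. infinite (Y j)"
  obtains r where "strict_mono r" "\<And>j. r j \<in> Y j"
proof -
  have "\<exists>r. \<forall>j. r j \<in> Y j \<and> r j < r (Suc j)"
  proof (rule dependent_nat_choice)
    show "\<exists>x. x \<in> Y 0" using assms[of 0] by (metis finite.emptyI all_not_in_conv)
    show "\<exists>y. y \<in> Y (Suc j) \<and> x < y" for x j
      using assms[of "Suc j"] infinite_nat_iff_unbounded by blast
  qed
  then show thesis using that by (auto simp: strict_mono_Suc_iff)
qed

text \<open>Cantor's theorem puts \<open>natLeq\<close> strictly below the continuum, so its
  successor embeds into the sets of naturals.\<close>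

lemma aleph1_reals:
  obtains W :: "nat set set" where "|W| =o cardSuc natLeq"
proof -
  have "natLeq <o |UNIV :: nat set set|"
    using card_of_Pow[of "UNIV :: nat set"] card_of_nat ordIso_ordLess_trans ordIso_symmetric
    by (metis Pow_UNIV)
  then have "cardSuc natLeq \<le>o |UNIV :: nat set set|"
    using cardSuc_ordLess_ordLeq[OF natLeq_Card_order card_of_Card_order] by blast
  moreover have fld: "|Field (cardSuc natLeq)| =o cardSuc natLeq"
    using card_of_Field_ordIso cardSuc_Card_order natLeq_Card_order by blast
  ultimately have "|Field (cardSuc natLeq)| \<le>o |UNIV :: nat set set|"
    by (rule ordIso_ordLeq_trans[rotated])
  then obtain f :: "_ \<Rightarrow> nat set" where f: "inj_on f (Field (cardSuc natLeq))"
    using card_of_ordLeq by metis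
  then have "|f ` Field (cardSuc natLeq)| =o |Field (cardSuc natLeq)|"
    using card_of_ordIso inj_on_imp_bij_betw ordIso_symmetric by blast
  then show thesis using that fld ordIso_transitive by blast
qed

lemma uncountable_pigeonhole:
  fixes d :: "'a \<Rightarrow> nat"
  assumes "uncountable W"
  obtains p where "infinite {x \<in> W. d x = p}"
proof -
  have "W = (\<Union>p. {x \<in> W. d x = p})" by blast
  then have "\<exists>p. uncountable {x \<in> W. d x = p}"
    using assms countable_UN[of UNIV "\<lambda>p. {x \<in> W. d x = p}"] by auto
  then show thesis using that countable_finite by blast
qed

section \<open>Construction of the gap\<close>

text \<open>A supposed separator yields in turn \<open>p\<close>, \<open>n\<close>,
  \<open>c\<close>, \<open>m\<close> and a pattern \<open>t\<close>, none tied to a particular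
  fragment. Every triple \<open>(n, m, t)\<close> has its own position \<open>j\<close>, so a
  fragment prepared for these data waits at \<open>r j\<close>.\<close>

lemma aleph1_gap_exists:
  assumes frag: "fragmentation a \<phi>" and ngf: "\<not> gradually_fragmented a \<phi>"
    and uni: "\<And>j. uniform_on (a j) (\<phi> j)"
  shows "\<exists>\<A> \<B>. ideal_gap (fragmented_ideal a \<phi>) \<A> \<B> \<and> |\<A>| =o natLeq \<and> |\<B>| =o cardSuc natLeq"
proof -
  let ?I = "fragmented_ideal a \<phi>"
  have ne: "a i \<noteq> {}" for i using frag unfolding fragmentation_def by blast
  have disj: "i = j" if "x \<in> a i" "x \<in> a j" for i j x
    using frag that unfolding fragmentation_def disjoint_family_on_def by blast
  have sub: "submeasure_on (a i) (\<phi> i)" for i using frag unfolding fragmentation_def by blast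
  obtain k N where inf: "\<And>m. infinite {i. \<exists>E. escaping_family (a i) (\<phi> i) k m (N m) E}"
    using not_gradually_fragmented_escaping[OF frag ngf uni] by blast
  obtain T :: "nat \<Rightarrow> nat set \<Rightarrow> nat" where
    T: "\<And>F f. finite F \<Longrightarrow> \<exists>t. \<forall>x\<in>F. T t x = f x"
    using countable_interpolating_family by blast
  obtain W :: "nat set set" where W: "|W| =o cardSuc natLeq" using aleph1_reals .
  \<comment> \<open>The position \<open>j\<close> codes a triple: colour, size parameter \<open>m\<close>, index of an interpolating pattern.\<close>
  define col where "col j = fst (prod_decode j)" for j
  define siz where "siz j = fst (prod_decode (snd (prod_decode j)))" for j
  define pat where "pat j = snd (prod_decode (snd (prod_decode j)))" for j
  \<comment> \<open>Infinitely many fragments suit each size, so every position gets its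
    own.\<close>
  obtain r where r: "strict_mono r"
      "\<And>j. r j \<in> {i. \<exists>E. escaping_family (a i) (\<phi> i) k (siz j) (N (siz j)) E}"
    using strict_mono_choice[of "\<lambda>j. {i. \<exists>E. escaping_family (a i) (\<phi> i) k (siz j) (N (siz j)) E}"] inf
    by blast
  from r(2) have "\<forall>j. \<exists>E. escaping_family (a (r j)) (\<phi> (r j)) k (siz j) (N (siz j)) E" by simp
  from choice[OF this] obtain E where
    E: "\<And>j. escaping_family (a (r j)) (\<phi> (r j)) k (siz j) (N (siz j)) (E j)"
    by blast
  have r_inj: "j = j'" if "r j = r j'" for j j'
    using r(1) that by (simp add: strict_mono_eq)
  have Ea: "E j v \<subseteq> a (r j)" for j v using E unfolding escaping_family_def by blast
  define A where "A n = (\<Union>j\<in>{j. col j = n}. a (r j))" for n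
  \<comment> \<open>The default \<open>{}\<close> enforces measure at most \<open>col j\<close>,
    which yields orthogonality to each \<open>A n\<close>.\<close>
  define piece where
    "piece x j = (if \<phi> (r j) (E j (T (pat j) x)) \<le> real (col j) then E j (T (pat j) x) else {})" for x j
  define B where "B x = (\<Union>j. piece x j)" for x
  have piece_sub: "piece x j \<subseteq> a (r j)" for x j using Ea unfolding piece_def by auto
  have B_frag: "B x \<inter> a (r j) = piece x j" for x j
    unfolding B_def using piece_sub disj r_inj by blast
  have A_frag: "A (col j) \<inter> a (r j) = a (r j)" for j unfolding A_def by auto
  have piece_le: "\<phi> (r j) (piece x j) \<le> real (col j)" for x j
    unfolding piece_def using submeasure_on_empty[OF sub] by auto
  \<comment> \<open>Every colour occurs, and fragments are nonempty and disjoint.\<close>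
  have "inj A"
  proof (rule injI)
    fix n n' assume eq: "A n = A n'"
    have n: "col (prod_encode (n, 0)) = n" unfolding col_def by simp
    obtain x where x: "x \<in> a (r (prod_encode (n, 0)))" using ne by blast
    then have "x \<in> A n'" using n eq unfolding A_def by auto
    then obtain j where "col j = n'" "x \<in> a (r j)" unfolding A_def by auto
    then show "n = n'" using disj[OF x] r_inj n by metis
  qed
  then have cA: "|range A| =o natLeq"
    by (metis card_of_nat card_of_ordIso inj_on_imp_bij_betw ordIso_symmetric ordIso_transitive)
  have orth: "orthogonal_mod ?I (range A) (B ` W)"
    unfolding orthogonal_mod_def
  proof (intro ballI)
    fix P Q assume "P \<in> range A" "Q \<in> B ` W"
    then obtain n x where PQ: "P = A n" "Q = B x" by auto
    have "\<phi> i (P \<inter> Q \<inter> a i) \<le> real n" for i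
    proof (cases "\<exists>j. i = r j \<and> col j = n")
      case True
      then obtain j where j: "i = r j" "col j = n" by blast
      then have "P \<inter> Q \<inter> a i \<subseteq> piece x j" using PQ B_frag by blast
      then have "\<phi> i (P \<inter> Q \<inter> a i) \<le> \<phi> (r j) (piece x j)"
        using submeasure_on_mono[OF sub _ piece_sub] j(1) by blast
      then show ?thesis using piece_le[of j x] j(2) by simp
    next
      case False
      then have "P \<inter> Q \<inter> a i = {}" using PQ disj unfolding A_def by blast
      then show ?thesis using submeasure_on_empty[OF sub] by simp
    qed
    then show "P \<inter> Q \<in> ?I" unfolding fragmented_ideal_iff[OF frag] by blast
  qed
  have "\<nexists>C. separates_mod ?I C (range A) (B ` W)"
  proof
    assume "\<exists>C. separates_mod ?I C (range A) (B ` W)"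
    then obtain C where C: "\<And>n. A n \<inter> C \<in> ?I" "\<And>x. x \<in> W \<Longrightarrow> B x - C \<in> ?I"
      unfolding separates_mod_def subset_mod_def by blast
    have "\<forall>x. \<exists>d::nat. x \<in> W \<longrightarrow> (\<forall>i. \<phi> i ((B x - C) \<inter> a i) \<le> real d)"
      using C(2) unfolding fragmented_ideal_iff[OF frag] by blast
    then obtain d :: "nat set \<Rightarrow> nat" where
      d: "\<And>x i. x \<in> W \<Longrightarrow> \<phi> i ((B x - C) \<inter> a i) \<le> real (d x)"
      by metis
    have "\<not> |W| \<le>o natLeq"
      using W cardSuc_greater[OF natLeq_Card_order]
      by (meson not_ordLess_ordLeq ordIso_iff_ordLeq ordLess_ordLeq_trans)
    then have "uncountable W" by (simp add: countable_card_le_natLeq)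
    then obtain p where p: "infinite {x \<in> W. d x = p}" by (rule uncountable_pigeonhole)
    \<comment> \<open>Makes \<open>(n - k) / 2\<close> equal to \<open>p + 1/2\<close>, just above
      the common bound \<open>p\<close>.\<close>
    define n where "n = 2 * p + k + 1"
    obtain c :: nat where c: "\<And>i. \<phi> i (A n \<inter> C \<inter> a i) \<le> real c"
      using C(1) unfolding fragmented_ideal_iff[OF frag] by blast
    \<comment> \<open>The least \<open>m\<close> whose budget admits this \<open>c\<close> and
      \<open>n\<close>.\<close>
    define m where "m = 2 * c + n"
    \<comment> \<open>With \<open>N m\<close> members, \<open>F\<close> can realise every candidate
      index through the bijection \<open>h\<close>.\<close>
    obtain F where F: "F \<subseteq> {x \<in> W. d x = p}" "finite F" "card F = N m"
      using infinite_arbitrarily_large[OF p] by blast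
    obtain h where h: "bij_betw h F {0..<N m}"
      using ex_bij_betw_finite_nat[OF F(2)] F(3) by auto
    obtain t where t: "\<And>x. x \<in> F \<Longrightarrow> T t x = h x" using T[OF F(2)] by blast
    define j where "j = prod_encode (n, prod_encode (m, t))"
    have j: "col j = n" "siz j = m" "pat j = t" unfolding col_def siz_def pat_def j_def by simp_all
    \<comment> \<open>Fragment \<open>r j\<close> lies inside \<open>A n\<close>, so the bound on
      \<open>A n \<inter> C\<close> bounds all of \<open>C\<close> there.\<close>
    have "C \<inter> a (r j) = A n \<inter> C \<inter> a (r j)" using A_frag[of j] j(1) by blast
    then have "\<phi> (r j) (C \<inter> a (r j)) \<le> real c" using c by simp
    then obtain v where v: "v < N m" "\<phi> (r j) (E j v) \<le> real n"
        "(real n - real k) / 2 \<le> \<phi> (r j) (E j v - C)"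
      using E[of j] unfolding escaping_family_def j(2) by (metis m_def order_refl)
    obtain x where x: "x \<in> F" "h x = v"
      using h v(1) by (metis atLeastLessThan_iff bij_betw_imp_surj_on imageE zero_le)
    have "piece x j = E j v" unfolding piece_def using j x t v(2) by simp
    then have "(B x - C) \<inter> a (r j) = E j v - C" using B_frag[of x j] by blast
    moreover have "x \<in> W" "d x = p" using x(1) F(1) by auto
    ultimately have "\<phi> (r j) (E j v - C) \<le> real p" using d[of x "r j"] by simp
    then show False using v(3) unfolding n_def by simp
  qed
  with orth have gap: "ideal_gap ?I (range A) (B ` W)" unfolding ideal_gap_def by blast
  \<comment> \<open>The image of \<open>W\<close> gives the upper bound;
    \<open>gap_uncountable\<close> gives the lower one, in place of injectivity of
    \<open>B\<close>.\<close>
  have "|B ` W| \<le>o cardSuc natLeq"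
    using card_of_image W by (rule ordLeq_ordIso_trans)
  then have "|B ` W| =o cardSuc natLeq"
    using gap_uncountable[OF frag gap cA] by (simp add: ordIso_iff_ordLeq)
  then show ?thesis using gap cA by blast
qed

theorem theorem3p4:
  fixes a :: "nat \<Rightarrow> nat set" and \<phi> :: "nat \<Rightarrow> nat set \<Rightarrow> real"
  assumes "fragmentation a \<phi>"
    and "\<not> gradually_fragmented a \<phi>"
    and "\<And>j. uniform_on (a j) (\<phi> j)"
  shows "is_rothberger_number (fragmented_ideal a \<phi>) (cardSuc natLeq)"
  unfolding is_rothberger_number_def
  using cardSuc_Card_order[OF natLeq_Card_order] aleph1_gap_exists[OF assms] gap_uncountable[OF assms(1)]
  by blast

end
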